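(* For any $d, \varepsilon > 0$, there exists $\delta > 0$ such that the following holds. Let $\phi$ be any 3SAT formula on $n$ variables such that $\mathrm{val}(\phi) \le 1 - \varepsilon$ and each variable appears in at most $d$ clauses, and let $\ell$ be any integer with $n^{3/4}/\delta \le \ell \le n/2$. Then every induced subgraph of $G_{\phi,\ell}$ on $\binom{n}{\ell}$ vertices has density at most $2^{-\delta \ell^4/n^3}$.
   Context: For a 3SAT formula $\phi$, $\mathrm{val}(\phi)$ denotes the maximum fraction of clauses satisfied by an assignment. The density of a graph on $N \ge 2$ vertices with edge set $E$ is $|E|/\binom{N}{2}$. Given a 3SAT formula $\phi$ on variables $x_1,\dots,x_n$ and an integer $1 \le \ell \le n$, the graph $G_{\phi,\ell}$ is defined as follows. Its vertices are all partial assignments to exactly $\ell$ variables, i.e. sets $\{(x_{i_1}, b_{i_1}),\dots,(x_{i_\ell}, b_{i_\ell})\}$ where $x_{i_1},\dots,x_{i_\ell}$ are $\ell$ distinct variables and $b_{i_j}\in\{0,1\}$. Two distinct vertices $u, v$ are adjacent iff (i) they are consistent (no variable is assigned $0$ in one and $1$ in the other), and (ii) every clause of $\phi$ all of whose variables lie among the variables appearing in $u$ or $v$ is satisfied by the partial assignment $u \cup v$. $\log$ denotes $\log_2$.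
   Formalization: The formula is required to have every one of its n variables occur in at least one clause; if unused variables were counted in n, a fixed unsatisfiable formula padded with unused variables would contradict the density bound. *)

theory Defs
  imports Complex_Main
begin

text \<open>
  The variables are \<open>x\<^sub>1, x\<^sub>2, \<dots>\<close>, named by natural numbers. A pair \<open>(x, b)\<close> is used in two ways: as the
  literal on \<open>x\<close> (negated iff \<open>b = False\<close>), and as the statement that \<open>x\<close> is assigned \<open>b\<close>.
  A partial assignment \<open>u\<close> therefore satisfies a clause \<open>c\<close> iff the two sets share an element.
  Formulas are lists, so a clause may be repeated, and is then counted with its multiplicity.
\<close>

type_synonym clause = "(nat \<times> bool) set"
type_synonym formula = "clause list"
type_synonym partial_assignment = "(nat \<times> bool) set"

definition formula_vars :: "formula \<Rightarrow> nat set" where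
  "formula_vars \<phi> = (\<Union>c\<in>set \<phi>. fst ` c)"

text \<open>
  A 3SAT formula on \<open>n\<close> variables: clauses have at most three literals, and \<open>x\<^sub>1, \<dots>, x\<^sub>n\<close> are exactly
  the variables occurring in it. Unused variables must not be counted in \<open>n\<close>: the number of clauses
  would otherwise be unrelated to \<open>n\<close>, and a fixed unsatisfiable formula padded with unused
  variables would have subgraphs of constant density.
\<close>

definition is_3sat :: "nat \<Rightarrow> formula \<Rightarrow> bool" where
  "is_3sat n \<phi> \<longleftrightarrow>
     (\<forall>c\<in>set \<phi>. finite c \<and> card c \<le> 3) \<and> formula_vars \<phi> = {1..n}"

definition occurrences :: "formula \<Rightarrow> nat \<Rightarrow> nat" where
  "occurrences \<phi> x = length (filter (\<lambda>c. x \<in> fst ` c) \<phi>)"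

definition satisfies :: "(nat \<Rightarrow> bool) \<Rightarrow> clause \<Rightarrow> bool" where
  "satisfies \<alpha> c \<longleftrightarrow> (\<exists>(x, b)\<in>c. \<alpha> x = b)"

definition sat_fraction :: "formula \<Rightarrow> (nat \<Rightarrow> bool) \<Rightarrow> real" where
  "sat_fraction \<phi> \<alpha> =
     (if \<phi> = [] then 1 else real (length (filter (satisfies \<alpha>) \<phi>)) / real (length \<phi>))"

text \<open>
  The maximum is over a finite set, since \<open>sat_fraction \<phi>\<close> only takes values \<open>k / length \<phi>\<close> with
  \<open>k \<le> length \<phi>\<close> (or \<open>1\<close>).
\<close>

definition val :: "formula \<Rightarrow> real" where
  "val \<phi> = Max (range (sat_fraction \<phi>))"

text \<open>Simple graphs, with edges as two-element sets of vertices.\<close>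

type_synonym 'a graph = "'a set \<times> 'a set set"

definition verts :: "'a graph \<Rightarrow> 'a set" where
  "verts G = fst G"

definition edges :: "'a graph \<Rightarrow> 'a set set" where
  "edges G = snd G"

definition induced_subgraph :: "'a graph \<Rightarrow> 'a set \<Rightarrow> 'a graph" where
  "induced_subgraph G S = (S, {e \<in> edges G. e \<subseteq> S})"

definition density :: "'a graph \<Rightarrow> real" where
  "density G = real (card (edges G)) / real (card (verts G) choose 2)"

definition partial_assignments :: "nat \<Rightarrow> nat \<Rightarrow> partial_assignment set" where
  "partial_assignments n l =
     {u. finite u \<and> inj_on fst u \<and> fst ` u \<subseteq> {1..n} \<and> card u = l}"

definition consistent :: "partial_assignment \<Rightarrow> partial_assignment \<Rightarrow> bool" where
  "consistent u v \<longleftrightarrow> (\<forall>x b b'. (x, b) \<in> u \<longrightarrow> (x, b') \<in> v \<longrightarrow> b = b')"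

definition adjacent :: "formula \<Rightarrow> partial_assignment \<Rightarrow> partial_assignment \<Rightarrow> bool" where
  "adjacent \<phi> u v \<longleftrightarrow> u \<noteq> v \<and> consistent u v \<and>
     (\<forall>c\<in>set \<phi>. fst ` c \<subseteq> fst ` u \<union> fst ` v \<longrightarrow> c \<inter> (u \<union> v) \<noteq> {})"

definition assignment_graph :: "nat \<Rightarrow> formula \<Rightarrow> nat \<Rightarrow> partial_assignment graph" where
  "assignment_graph n \<phi> l =
     (partial_assignments n l,
      {{u, v} | u v. u \<in> partial_assignments n l \<and> v \<in> partial_assignments n l \<and> adjacent \<phi> u v})"

end

theory Submission
  imports Defs "HOL-Analysis.Convex"
begin

text \<open>
  If the subgraph had too large a density \<open>D\<close>, convexity would give at least \<open>N ^ (2 * t) * D ^ (t * t)\<close>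
  labelled bicliques \<open>us\<close>, \<open>vs\<close> with \<open>t\<close> vertices on each side, where \<open>N = n choose l\<close>. On the other
  hand, let \<open>A\<close> and \<open>B\<close> be the unions of the two sides of a biclique. By consistency, every variable
  has at most two pairs in \<open>A\<close> and \<open>B\<close> together. If most variables have the same single value in \<open>A\<close>
  and in \<open>B\<close>, these values form an assignment that violates linearly many clauses, and since \<open>A\<close>
  assigns one variable of such a clause, no \<open>vs j\<close> may contain the other two. In every case the sides
  avoid linearly many disjoint pairs or \<open>A\<close> and \<open>B\<close> are smaller than expected, and estimating with
  the weights \<open>z ^ l\<close> at \<open>z = l / (n - l)\<close> shows that a pair \<open>(us i, vs j)\<close> has at most
  \<open>(n + 1)\<^sup>2 * N\<^sup>2 * exp (- \<gamma> * l\<^sup>2 / n)\<close> possible values. With \<open>t\<close> of order \<open>n\<^sup>2 / l\<^sup>2\<close> the two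
  bounds contradict each other.
\<close>

section \<open>Lower bound on the number of bicliques by convexity\<close>

lemma power_mean:
  fixes f :: "'a \<Rightarrow> real"
  assumes "finite A" "A \<noteq> {}" "\<And>x. x \<in> A \<Longrightarrow> 0 \<le> f x"
  shows "((\<Sum>x\<in>A. f x) / card A) ^ t \<le> (\<Sum>x\<in>A. f x ^ t) / card A"
proof -
  have "convex_on {0::real..} (\<lambda>x. x ^ t)"
  proof (rule convex_on_realI)
    show "((\<lambda>x. x ^ t) has_real_derivative real t * x ^ (t - 1)) (at x)" for x :: real
      by (auto intro!: derivative_eq_intros)
  qed (auto intro!: mult_left_mono power_mono)
  from convex_on_sum[OF assms(1,2) this, of "\<lambda>_. 1 / card A" f] assms
  show ?thesis
    by (simp add: sum_divide_distrib)
qed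

text \<open>Labelled tuples with repetitions: choosing \<open>t\<close> vertices from a set of size
  \<open>m\<close> has exactly \<open>m ^ t\<close> outcomes, the form to which
  \<open>power_mean\<close> applies. Extensional functions keep the set of tuples finite.\<close>

definition bicliques :: "'a set \<Rightarrow> ('a \<Rightarrow> 'a \<Rightarrow> bool) \<Rightarrow> nat \<Rightarrow> ((nat \<Rightarrow> 'a) \<times> (nat \<Rightarrow> 'a)) set" where
  "bicliques S R t = {(us, vs). us \<in> {..<t} \<rightarrow>\<^sub>E S \<and> vs \<in> {..<t} \<rightarrow>\<^sub>E S \<and> (\<forall>i<t. \<forall>j<t. R (us i) (vs j))}"

lemma finite_bicliques: "finite S \<Longrightarrow> finite (bicliques S R t)"
  by (rule finite_subset[of _ "({..<t} \<rightarrow>\<^sub>E S) \<times> ({..<t} \<rightarrow>\<^sub>E S)"])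
    (auto simp: bicliques_def intro!: finite_PiE)

text \<open>\<open>power_mean\<close> is used twice: on the degrees over \<open>S\<close>, which
  bounds the number of stars with \<open>t\<close> leaves, and then on the numbers of common
  neighbours over all tuples \<open>vs\<close>.\<close>

lemma card_bicliques_ge:
  assumes S: "finite S" "S \<noteq> {}"
  shows "(real (card S) ^ 2) ^ t * (card {(u, v) \<in> S \<times> S. R u v} / real (card S) ^ 2) ^ (t * t)
           \<le> card (bicliques S R t)"
proof -
  define T where "T = ({..<t} \<rightarrow>\<^sub>E S)"
  define N where "N = real (card S)"
  define e where "e = real (card {(u, v) \<in> S \<times> S. R u v})"
  define common where "common vs = {u \<in> S. \<forall>j<t. R u (vs j)}" for vs :: "nat \<Rightarrow> 'a"
  have N: "N > 0"
    using S by (simp add: N_def card_gt_0_iff)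
  have T: "finite T" "T \<noteq> {}" "real (card T) = N ^ t"
  proof -
    show "finite T"
      unfolding T_def using S(1) by (intro finite_PiE) auto
    show "T \<noteq> {}"
      unfolding T_def PiE_eq_empty_iff using S(2) by simp
    show "real (card T) = N ^ t"
      by (simp add: T_def N_def card_funcsetE)
  qed
  have tuples: "card {f \<in> T. \<forall>j<t. Q (f j)} = card {x \<in> S. Q x} ^ t" for Q
  proof -
    have "{f \<in> T. \<forall>j<t. Q (f j)} = ({..<t} \<rightarrow>\<^sub>E {x \<in> S. Q x})"
      by (intro set_eqI) (unfold T_def PiE_iff mem_Collect_eq, blast)
    then show ?thesis
      by (simp add: card_funcsetE)
  qed
  have e: "(\<Sum>u\<in>S. card {v \<in> S. R u v}) = card {(u, v) \<in> S \<times> S. R u v}"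
  proof -
    have "{(u, v) \<in> S \<times> S. R u v} = (SIGMA u:S. {v \<in> S. R u v})"
      by auto
    then show ?thesis
      using S by (simp add: card_SigmaI)
  qed
  \<comment> \<open>Both sides count the stars: pairs \<open>(u, vs)\<close> with \<open>u\<close>
    related to every \<open>vs j\<close>.\<close>
  have "(\<Sum>vs\<in>T. card (common vs)) = (\<Sum>u\<in>S. card {vs \<in> T. \<forall>j<t. R u (vs j)})"
    unfolding common_def by (rule sum_multicount_gen[OF T(1) S(1)]) simp
  also have "\<dots> = (\<Sum>u\<in>S. card {v \<in> S. R u v} ^ t)"
    by (simp add: tuples)
  finally have c: "(\<Sum>vs\<in>T. real (card (common vs))) = (\<Sum>u\<in>S. real (card {v \<in> S. R u v}) ^ t)"
    by (simp flip: of_nat_sum of_nat_power)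
  have "(e / N) ^ t = ((\<Sum>u\<in>S. real (card {v \<in> S. R u v})) / card S) ^ t"
    unfolding e_def N_def e[symmetric] by simp
  also have "\<dots> \<le> (\<Sum>u\<in>S. real (card {v \<in> S. R u v}) ^ t) / card S"
    by (intro power_mean S) auto
  also have "\<dots> = (\<Sum>vs\<in>T. real (card (common vs))) / N"
    by (simp only: c N_def)
  finally have "(e / N) ^ t \<le> (\<Sum>vs\<in>T. real (card (common vs))) / N" .
  then have "N * (e / N) ^ t / N ^ t \<le> (\<Sum>vs\<in>T. real (card (common vs))) / N ^ t"
    using N by (simp add: field_simps)
  then have "(N * (e / N) ^ t / N ^ t) ^ t \<le> ((\<Sum>vs\<in>T. real (card (common vs))) / card T) ^ t"
    unfolding T using N by (intro power_mono) (auto simp: e_def)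
  also have "\<dots> \<le> (\<Sum>vs\<in>T. real (card (common vs)) ^ t) / card T"
    by (intro power_mean T) auto
  finally have "N ^ t * (N * (e / N) ^ t / N ^ t) ^ t \<le> (\<Sum>vs\<in>T. real (card (common vs)) ^ t)"
    unfolding T using N by (simp add: field_simps)
  \<comment> \<open>The \<open>t\<close>-tuples from \<open>common vs\<close> are exactly the left
    sides \<open>us\<close> that complete \<open>vs\<close> to a biclique.\<close>
  also have "\<dots> = real (\<Sum>vs\<in>T. card {us \<in> T. \<forall>i<t. \<forall>j<t. R (us i) (vs j)})"
    unfolding tuples[of "\<lambda>u. \<forall>j<t. R u (vs j)" for vs] common_def by simp
  also have "(\<Sum>vs\<in>T. card {us \<in> T. \<forall>i<t. \<forall>j<t. R (us i) (vs j)}) = card (bicliques S R t)"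
  proof -
    have "bicliques S R t = prod.swap ` (SIGMA vs:T. {us \<in> T. \<forall>i<t. \<forall>j<t. R (us i) (vs j)})"
      by (auto simp: bicliques_def T_def image_iff)
    then show ?thesis
      using T(1) by (simp add: card_image card_SigmaI)
  qed
  also have "N ^ t * (N * (e / N) ^ t / N ^ t) ^ t = (N ^ 2) ^ t * (e / N ^ 2) ^ (t * t)"
    by (simp add: power_divide power_mult power_mult_distrib power2_eq_square)
  finally show ?thesis
    by (simp add: e_def N_def)
qed

section \<open>Families of sets that contain no edge of a matching\<close>

text \<open>With weights \<open>z ^ card w\<close>, the subsets of \<open>U\<close> have total
  weight \<open>(1 + z) ^ card U\<close>, one factor per element. The edges are disjoint, so each of
  them independently replaces its factor \<open>(1 + z) ^ 2\<close> by \<open>1 + 2 * z\<close>, the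
  weight of its proper subsets. Powers on both sides avoid a division.\<close>

lemma sum_avoiding_matching:
  fixes z :: real
  assumes "finite M" "finite U" "\<And>e. e \<in> M \<Longrightarrow> card e = 2 \<and> e \<subseteq> U" "pairwise disjnt M"
  shows "(\<Sum>w | w \<subseteq> U \<and> (\<forall>e\<in>M. \<not> e \<subseteq> w). z ^ card w) * (1 + z) ^ (2 * card M)
           = (1 + 2 * z) ^ card M * (1 + z) ^ card U"
  using assms
proof (induction M arbitrary: U rule: finite_induct)
  case empty
  have "(1 + z) ^ card U = (\<Prod>x\<in>U. z + 1)"
    by (simp add: add.commute)
  also have "\<dots> = (\<Sum>w\<in>Pow U. z ^ card w)"
    by (subst prod_add) (simp_all add: empty)
  finally show ?case
    by (simp add: Pow_def)
next
  case (insert e M)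
  obtain a b where e: "e = {a, b}" "a \<noteq> b"
    using insert.prems(2)[of e] by (auto simp: card_2_iff)
  have ab: "a \<in> U" "b \<in> U"
    using insert.prems(2)[of e] e by auto
  have disj: "disjnt e f" if "f \<in> M" for f
    using insert.prems(3) insert.hyps(2) that by (auto simp: pairwise_insert)
  define V where "V = U - {a, b}"
  have V: "finite V" "a \<notin> V" "b \<notin> V" "U = insert a (insert b V)" "card U = card V + 2"
  proof -
    show U: "finite V" "a \<notin> V" "b \<notin> V" "U = insert a (insert b V)"
      using insert.prems(1) ab by (auto simp: V_def)
    then show "card U = card V + 2"
      using e(2) by simp
  qed
  define F where "F = {w. w \<subseteq> V \<and> (\<forall>e\<in>M. \<not> e \<subseteq> w)}"
  have finF: "finite F"
    using V(1) by (auto simp: F_def)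
  have MV: "f \<subseteq> V" if "f \<in> M" for f
    using disj[OF that] insert.prems(2)[of f] that e by (auto simp: V_def disjnt_def)
  \<comment> \<open>A set avoiding \<open>e\<close> contains neither end, only \<open>a\<close>, or
    only \<open>b\<close>; what remains in \<open>V\<close> is an arbitrary member of
    \<open>F\<close>.\<close>
  have *: "{w. w \<subseteq> U \<and> (\<forall>e\<in>insert e M. \<not> e \<subseteq> w)} = F \<union> insert a ` F \<union> insert b ` F"
    (is "?L = ?R")
  proof
    show "?L \<subseteq> ?R"
    proof
      fix w assume w: "w \<in> ?L"
      then have "w - {a, b} \<in> F"
        using MV V(4) by (auto simp: F_def)
      moreover have "w = w - {a, b} \<or> w = insert a (w - {a, b}) \<or> w = insert b (w - {a, b})"
        using w e by auto
      ultimately show "w \<in> ?R"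
        by (metis UnCI imageI)
    qed
    have L: "w \<in> ?L \<and> insert x w \<in> ?L" if w: "w \<in> F" and x: "x \<in> {a, b}" for w x
    proof -
      have "\<not> f \<subseteq> w" "\<not> f \<subseteq> insert x w" if f: "f \<in> M" for f
      proof -
        have "x \<notin> f"
          using MV[OF f] x V(2,3) by blast
        then show "\<not> f \<subseteq> w" "\<not> f \<subseteq> insert x w"
          using f w by (simp_all add: F_def subset_insert)
      qed
      moreover have "w \<subseteq> V"
        using w by (simp add: F_def)
      then have "\<not> e \<subseteq> w" "\<not> e \<subseteq> insert x w" "w \<subseteq> U" "insert x w \<subseteq> U"
        using x V(2-4) e by auto
      ultimately show ?thesis
        by simp
    qed
    show "?R \<subseteq> ?L"
    proof (intro Un_least subsetI)
      fix w assume "w \<in> F"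
      then show "w \<in> ?L"
        using L[of w a] by simp
    next
      fix w assume "w \<in> insert a ` F"
      then obtain w' where "w' \<in> F" "w = insert a w'" ..
      then show "w \<in> ?L"
        using L[of w' a] by simp
    next
      fix w assume "w \<in> insert b ` F"
      then obtain w' where "w' \<in> F" "w = insert b w'" ..
      then show "w \<in> ?L"
        using L[of w' b] by simp
    qed
  qed
  have notin: "a \<notin> w" "b \<notin> w" "finite w" if "w \<in> F" for w
  proof -
    have "w \<subseteq> V"
      using that by (simp add: F_def)
    with V(1-3) show "a \<notin> w" "b \<notin> w" "finite w"
      by (auto intro: finite_subset)
  qed
  have shift: "(\<Sum>w\<in>insert x ` F. z ^ card w) = z * (\<Sum>w\<in>F. z ^ card w)" if "x \<in> {a, b}" for x
    using that notin
    by (subst sum.reindex) (auto simp: inj_on_def sum_distrib_left insert_ident intro!: sum.cong)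
  have "(\<Sum>w\<in>F \<union> insert a ` F \<union> insert b ` F. z ^ card w) =
      (\<Sum>w\<in>F. z ^ card w) + (\<Sum>w\<in>insert a ` F. z ^ card w) + (\<Sum>w\<in>insert b ` F. z ^ card w)"
  proof -
    have "F \<inter> insert a ` F = {}" "(F \<union> insert a ` F) \<inter> insert b ` F = {}"
      using notin(1,2) e(2) by blast+
    then show ?thesis
      using finF by (simp add: sum.union_disjoint)
  qed
  also have "\<dots> = (\<Sum>w\<in>F. z ^ card w) + z * (\<Sum>w\<in>F. z ^ card w) + z * (\<Sum>w\<in>F. z ^ card w)"
    by (simp add: shift)
  finally have "(\<Sum>w | w \<subseteq> U \<and> (\<forall>e\<in>insert e M. \<not> e \<subseteq> w). z ^ card w) = (1 + 2 * z) * (\<Sum>w\<in>F. z ^ card w)"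
    unfolding * by (simp add: ring_distribs)
  moreover have "(\<Sum>w\<in>F. z ^ card w) * (1 + z) ^ (2 * card M) = (1 + 2 * z) ^ card M * (1 + z) ^ card V"
    unfolding F_def using insert.prems MV V(1) by (intro insert.IH) (auto simp: pairwise_insert)
  ultimately show ?case
    using insert.hyps by (simp add: V(5) algebra_simps)
qed

text \<open>The members of \<open>W\<close> all have weight \<open>z ^ l\<close> and are among the
  sets of the sum above, whose other terms are nonnegative.\<close>

lemma card_avoiding_matching:
  fixes z :: real
  assumes "z \<ge> 0" "finite M" "finite U" "\<And>e. e \<in> M \<Longrightarrow> card e = 2 \<and> e \<subseteq> U" "pairwise disjnt M"
    and W: "\<And>w. w \<in> W \<Longrightarrow> w \<subseteq> U \<and> card w = l \<and> (\<forall>e\<in>M. \<not> e \<subseteq> w)"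
  shows "card W * z ^ l * (1 + z) ^ (2 * card M) \<le> (1 + 2 * z) ^ card M * (1 + z) ^ card U"
proof -
  have "card W * z ^ l = (\<Sum>w\<in>W. z ^ card w)"
    using W by simp
  also have "\<dots> \<le> (\<Sum>w | w \<subseteq> U \<and> (\<forall>e\<in>M. \<not> e \<subseteq> w). z ^ card w)"
  proof (rule sum_mono2)
    show "finite {w. w \<subseteq> U \<and> (\<forall>e\<in>M. \<not> e \<subseteq> w)}"
      using assms(3) by simp
    show "W \<subseteq> {w. w \<subseteq> U \<and> (\<forall>e\<in>M. \<not> e \<subseteq> w)}"
      using W by blast
  qed (use assms(1) in simp)
  finally show ?thesis
    using assms(1) by (subst sum_avoiding_matching[OF assms(2-5), symmetric])
      (auto intro!: mult_right_mono)
qed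

section \<open>The largest term of the binomial expansion\<close>

text \<open>The terms are proportional to the binomial distribution with success probability
  \<open>l / n\<close>, whose mode is \<open>l\<close>. The quotient of successive terms,
  cross-multiplied in \<open>ratio\<close>, shows that they do not decrease before \<open>l\<close>
  and do not increase after it.\<close>

lemma binomial_term_le_mode:
  fixes n l k :: nat
  assumes "l < n" "k \<le> n"
  defines "z \<equiv> real l / real (n - l)"
  shows "real (n choose k) * z ^ k \<le> real (n choose l) * z ^ l"
proof -
  have ratio: "real (n choose Suc i) * z ^ Suc i * (real (Suc i) * (n - l)) =
      real (n choose i) * z ^ i * (real l * (real n - i))" if "i \<le> n" for i
  proof -
    have "Suc i * (n choose Suc i) = (n - i) * (n choose i)"
      using that by (metis binomial_absorb_comp binomial_absorption mult.commute)
    then have 1: "real (Suc i) * (n choose Suc i) = (real n - i) * (n choose i)"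
      using that by (metis of_nat_diff of_nat_mult)
    have 2: "z * (n - l) = l"
      using assms by (simp add: z_def)
    have "real (n choose Suc i) * z ^ Suc i * (real (Suc i) * (n - l)) =
        (real (Suc i) * (n choose Suc i)) * z ^ i * (z * (n - l))"
      by simp
    also have "\<dots> = real (n choose i) * z ^ i * (real l * (real n - i))"
      unfolding 1 2 by simp
    finally show ?thesis .
  qed
  have z: "z \<ge> 0"
    by (simp add: z_def)
  have up: "real (n choose i) * z ^ i \<le> real (n choose Suc i) * z ^ Suc i" if "i < l" for i
  proof -
    have "real (Suc i) * real (n - l) \<le> real l * (real n - i)"
    proof -
      have "(real i + 1) * n \<le> real l * n"
        using that by (intro mult_right_mono) linarith+
      then show ?thesis
        using assms(1) that by (simp add: of_nat_diff algebra_simps)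
    qed
    then have "real (n choose i) * z ^ i * (real (Suc i) * (n - l)) \<le> real (n choose i) * z ^ i * (real l * (real n - i))"
      using z by (intro mult_left_mono) auto
    also have "\<dots> = real (n choose Suc i) * z ^ Suc i * (real (Suc i) * (n - l))"
      using that assms(1) by (subst ratio) auto
    finally show ?thesis
      using assms(1) by (subst (asm) mult_le_cancel_right) auto
  qed
  have down: "real (n choose Suc i) * z ^ Suc i \<le> real (n choose i) * z ^ i" if "l \<le> i" "i < n" for i
  proof -
    have "real l * (real n - i) \<le> real (Suc i) * real (n - l)"
    proof -
      have "real l * n \<le> real i * n"
        using that by (intro mult_right_mono) linarith+
      moreover have "real l * (real n - i) = real l * n - real l * i"
        "real (Suc i) * real (n - l) = real i * n + n - real l * i - l"
        using assms(1) by (simp_all add: of_nat_diff algebra_simps)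
      moreover have "real l \<le> real n"
        using assms(1) by simp
      ultimately show ?thesis
        by linarith
    qed
    then have "real (n choose i) * z ^ i * (real l * (real n - i)) \<le> real (n choose i) * z ^ i * (real (Suc i) * (n - l))"
      using z by (intro mult_left_mono) auto
    then have "real (n choose Suc i) * z ^ Suc i * (real (Suc i) * (n - l)) \<le> real (n choose i) * z ^ i * (real (Suc i) * (n - l))"
      using that by (subst ratio) auto
    then show ?thesis
      using assms(1) by (subst (asm) mult_le_cancel_right) auto
  qed
  show ?thesis
  proof (cases "k \<le> l")
    case True
    then show ?thesis
    proof (induction k rule: inc_induct)
      case (step m)
      then show ?case
        using up[of m] by linarith
    qed simp
  next
    case False
    then have "l \<le> k" by simp
    then show ?thesis
      using \<open>k \<le> n\<close>
    proof (induction k rule: dec_induct)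
      case (step m)
      then show ?case
        using down[of m] by simp
    qed simp
  qed
qed

text \<open>The expansion has \<open>n + 1\<close> terms, none above the one at \<open>l\<close>.
  Hence counting \<open>l\<close>-sets by weights at this \<open>z\<close> loses only a factor
  \<open>n + 1\<close>.\<close>

lemma power_le_binomial_mode:
  fixes n l :: nat
  assumes "l < n"
  defines "z \<equiv> real l / real (n - l)"
  shows "(1 + z) ^ n \<le> (real n + 1) * (real (n choose l) * z ^ l)"
proof -
  have "(1 + z) ^ n = (\<Sum>k\<le>n. real (n choose k) * z ^ k)"
    using binomial_ring[of z 1 n] by (simp add: add.commute)
  also have "\<dots> \<le> (\<Sum>k\<le>n. real (n choose l) * z ^ l)"
    unfolding z_def using assms(1) by (intro sum_mono binomial_term_le_mode) auto
  finally show ?thesis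
    by (simp add: algebra_simps)
qed

section \<open>The number of violated clauses\<close>

text \<open>A union bound over list entries, so that repeated clauses count with their
  multiplicity.\<close>

lemma length_filter_le_sum:
  assumes "finite T" "\<And>c. c \<in> set xs \<Longrightarrow> P c \<Longrightarrow> \<exists>x\<in>T. Q x c"
  shows "length (filter P xs) \<le> (\<Sum>x\<in>T. length (filter (Q x) xs))"
  using assms(2)
proof (induction xs)
  case (Cons c xs)
  have IH: "length (filter P xs) \<le> (\<Sum>x\<in>T. length (filter (Q x) xs))"
    using Cons.prems by (intro Cons.IH) auto
  have mono: "(\<Sum>x\<in>T. length (filter (Q x) xs)) \<le> (\<Sum>x\<in>T. length (filter (Q x) (c # xs)))"
    by (intro sum_mono) auto
  show ?case
  proof (cases "P c")
    case True
    then obtain x where "x \<in> T" "Q x c"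
      using Cons.prems[of c] by auto
    then have "(\<Sum>x\<in>T. length (filter (Q x) xs)) < (\<Sum>x\<in>T. length (filter (Q x) (c # xs)))"
      using assms(1) by (intro sum_strict_mono_ex1) auto
    then show ?thesis
      using True IH by simp
  next
    case False
    then show ?thesis
      using IH mono by simp
  qed
qed simp

text \<open>Every variable occurs in some clause. This turns a fraction of the clauses into a number
  linear in \<open>n\<close>.\<close>

lemma is_3sat_card_le:
  assumes "is_3sat n \<phi>"
  shows "n \<le> 3 * length \<phi>"
proof -
  have "n = card (\<Union>c\<in>set \<phi>. fst ` c)"
    using assms by (simp add: is_3sat_def formula_vars_def)
  also have "\<dots> \<le> (\<Sum>c\<in>set \<phi>. card (fst ` c))"
    by (rule card_UN_le) simp
  also have "\<dots> \<le> (\<Sum>c\<in>set \<phi>. 3)"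
  proof (rule sum_mono)
    fix c assume "c \<in> set \<phi>"
    then have "finite c" "card c \<le> 3"
      using assms by (auto simp: is_3sat_def)
    then show "card (fst ` c) \<le> 3"
      using card_image_le order_trans by blast
  qed
  also have "\<dots> \<le> 3 * length \<phi>"
    by (simp add: card_length)
  finally show ?thesis .
qed

lemma sat_fraction_le_val: "sat_fraction \<phi> \<alpha> \<le> val \<phi>"
proof -
  have "range (sat_fraction \<phi>) \<subseteq> insert 1 ((\<lambda>k. real k / real (length \<phi>)) ` {..length \<phi>})"
    by (auto simp: sat_fraction_def)
  then have "finite (range (sat_fraction \<phi>))"
    by (rule finite_subset) simp
  then show ?thesis
    unfolding val_def by (intro Max_ge) auto
qed

lemma unsatisfied_clauses_ge:
  assumes "is_3sat n \<phi>" "val \<phi> \<le> 1 - \<epsilon>" "\<epsilon> > 0"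
  shows "\<epsilon> * n / 3 \<le> length (filter (\<lambda>c. \<not> satisfies \<alpha> c) \<phi>)"
proof -
  have le: "sat_fraction \<phi> \<alpha> \<le> 1 - \<epsilon>"
    using sat_fraction_le_val[of \<phi> \<alpha>] assms(2) by simp
  \<comment> \<open>The empty formula has \<open>sat_fraction\<close> equal to \<open>1\<close>,
    which exceeds \<open>1 - \<epsilon>\<close>.\<close>
  then have ne: "\<phi> \<noteq> []"
    using assms(3) by (auto simp: sat_fraction_def)
  have "real (length (filter (satisfies \<alpha>) \<phi>)) \<le> (1 - \<epsilon>) * length \<phi>"
    using le ne by (simp add: sat_fraction_def divide_le_eq)
  moreover have "length (filter (satisfies \<alpha>) \<phi>) + length (filter (\<lambda>c. \<not> satisfies \<alpha> c) \<phi>) = length \<phi>"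
    by (rule sum_length_filter_compl)
  then have "real (length (filter (satisfies \<alpha>) \<phi>)) + length (filter (\<lambda>c. \<not> satisfies \<alpha> c) \<phi>) = length \<phi>"
    by (metis of_nat_add)
  ultimately have "\<epsilon> * length \<phi> \<le> length (filter (\<lambda>c. \<not> satisfies \<alpha> c) \<phi>)"
    by (simp add: algebra_simps)
  moreover have "real n \<le> 3 * length \<phi>"
    using is_3sat_card_le[OF assms(1)] by linarith
  then have "\<epsilon> * n \<le> \<epsilon> * (3 * length \<phi>)"
    using assms(3) by (intro mult_left_mono) auto
  ultimately show ?thesis
    by linarith
qed

section \<open>Variables classified by their pairs in the two sides\<close>

text \<open>\<open>A\<close> stands for the union of one side of a biclique. A variable with both
  values there yields a pair that no single partial assignment contains.\<close>

definition doubled :: "nat \<Rightarrow> (nat \<times> bool) set \<Rightarrow> nat set" where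
  "doubled n A = {x \<in> {1..n}. (x, True) \<in> A \<and> (x, False) \<in> A}"

definition doubled_pairs :: "nat \<Rightarrow> (nat \<times> bool) set \<Rightarrow> (nat \<times> bool) set set" where
  "doubled_pairs n A = (\<lambda>x. {(x, True), (x, False)}) ` doubled n A"

text \<open>On these variables the two sides determine one common value, so they can be tested
  against the clauses.\<close>

definition agreed :: "nat \<Rightarrow> (nat \<times> bool) set \<Rightarrow> (nat \<times> bool) set \<Rightarrow> nat set" where
  "agreed n A B = {x \<in> {1..n}.
    ((x, True) \<in> A) \<noteq> ((x, False) \<in> A) \<and>
    ((x, True) \<in> B) = ((x, True) \<in> A) \<and> ((x, False) \<in> B) = ((x, False) \<in> A)}"

text \<open>For consistent \<open>A\<close> and \<open>B\<close>, these are the variables with at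
  most one pair in the two sides together; all others have exactly two.\<close>

definition missing :: "nat \<Rightarrow> (nat \<times> bool) set \<Rightarrow> (nat \<times> bool) set \<Rightarrow> nat set" where
  "missing n A B = {1..n} - doubled n A - doubled n B - agreed n A B"

lemma doubled_pairs:
  shows "card (doubled_pairs n A) = card (doubled n A)" "finite (doubled_pairs n A)"
    "pairwise disjnt (doubled_pairs n A)"
    "e \<in> doubled_pairs n A \<Longrightarrow> card e = 2 \<and> e \<subseteq> A \<and> fst ` e \<subseteq> doubled n A"
    "e \<in> doubled_pairs n A \<Longrightarrow> inj_on fst u \<Longrightarrow> \<not> e \<subseteq> u"
proof -
  have "inj_on (\<lambda>x. {(x, True), (x, False)}) (doubled n A)"
    by (auto simp: inj_on_def doubleton_eq_iff)
  then show "card (doubled_pairs n A) = card (doubled n A)"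
    by (simp add: doubled_pairs_def card_image)
  show "finite (doubled_pairs n A)" "pairwise disjnt (doubled_pairs n A)"
    by (simp_all add: doubled_pairs_def doubled_def pairwise_image) (simp add: pairwise_def disjnt_def)
  show "card e = 2 \<and> e \<subseteq> A \<and> fst ` e \<subseteq> doubled n A" if "e \<in> doubled_pairs n A"
    using that by (auto simp: doubled_pairs_def doubled_def)
  show "\<not> e \<subseteq> u" if e: "e \<in> doubled_pairs n A" and u: "inj_on fst u"
  proof
    assume "e \<subseteq> u"
    then obtain x where "(x, True) \<in> u" "(x, False) \<in> u"
      using e by (auto simp: doubled_pairs_def)
    then show False
      using inj_onD[OF u, of "(x, True)" "(x, False)"] by simp
  qed
qed

text \<open>Checked variable by variable: consistency allows at most two pairs, and a missing
  variable has at most one.\<close>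

lemma card_sides_le:
  assumes "A \<subseteq> {1..n} \<times> UNIV" "B \<subseteq> {1..n} \<times> UNIV" "consistent A B"
  shows "card A + card B + card (missing n A B) \<le> 2 * n"
proof -
  have fib: "card C = (\<Sum>x\<in>{1..n}. of_bool ((x, True) \<in> C) + of_bool ((x, False) \<in> C))"
    if "C \<subseteq> {1..n} \<times> UNIV" for C :: "(nat \<times> bool) set"
  proof -
    have "(SIGMA x:{1..n}. {b. (x, b) \<in> C}) = C"
      using that by auto
    moreover have "card (SIGMA x:{1..n}. {b. (x, b) \<in> C}) = (\<Sum>x\<in>{1..n}. card {b. (x, b) \<in> C})"
      by (simp add: card_SigmaI)
    ultimately have "card C = (\<Sum>x\<in>{1..n}. card {b. (x, b) \<in> C})"
      by simp
    moreover have "card {b. (x, b) \<in> C} = of_bool ((x, True) \<in> C) + of_bool ((x, False) \<in> C)" for x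
    proof -
      have "{b. (x, b) \<in> C} = (if (x, True) \<in> C then {True} else {}) \<union> (if (x, False) \<in> C then {False} else {})"
        by (auto split: if_splits) (metis (full_types))+
      then show ?thesis
        by simp
    qed
    ultimately show ?thesis
      by simp
  qed
  have "card (missing n A B) = (\<Sum>x\<in>{1..n}. of_bool (x \<in> missing n A B))"
  proof -
    have "{1..n} \<inter> {x. x \<in> missing n A B} = missing n A B"
      by (auto simp: missing_def)
    then show ?thesis
      by (simp add: sum_of_bool_eq)
  qed
  then have "card A + card B + card (missing n A B) =
      (\<Sum>x\<in>{1..n}. of_bool ((x, True) \<in> A) + of_bool ((x, False) \<in> A) +
         (of_bool ((x, True) \<in> B) + of_bool ((x, False) \<in> B)) + of_bool (x \<in> missing n A B))"
    using fib[OF assms(1)] fib[OF assms(2)] by (simp add: sum.distrib)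
  also have "\<dots> \<le> (\<Sum>x\<in>{1..n}. 2)"
  proof (rule sum_mono)
    fix x assume x: "x \<in> {1..n}"
    have "\<not> ((x, b) \<in> A \<and> (x, \<not> b) \<in> B)" for b
      using assms(3) by (auto simp: consistent_def)
    from this[of True] this[of False]
    show "of_bool ((x, True) \<in> A) + of_bool ((x, False) \<in> A) +
         (of_bool ((x, True) \<in> B) + of_bool ((x, False) \<in> B)) + of_bool (x \<in> missing n A B) \<le> (2 :: nat)"
      using x
      by (cases "(x, True) \<in> A"; cases "(x, False) \<in> A"; cases "(x, True) \<in> B"; cases "(x, False) \<in> B")
        (auto simp: missing_def doubled_def agreed_def)
  qed
  finally show ?thesis
    by simp
qed

text \<open>
  The point is that \<open>x \<in> c\<close> is assigned in some \<open>u\<close>, so that no \<open>v \<in> W\<close>, each being adjacent to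
  this \<open>u\<close>, may assign both of the other two variables of the violated clause \<open>c\<close>.
\<close>

lemma forbidden_pair:
  assumes c: "finite c" "card c \<le> 3" "c \<in> set \<phi>" "\<not> satisfies (\<lambda>x. (x, True) \<in> A) c"
    and good: "fst ` c \<subseteq> agreed n A B"
    and W: "\<Union>W = B" "W \<noteq> {}" and A: "A \<noteq> {}"
    and adj: "\<And>v p. v \<in> W \<Longrightarrow> p \<in> A \<Longrightarrow> \<exists>u. p \<in> u \<and> u \<subseteq> A \<and> adjacent \<phi> u v"
  shows "\<exists>e. card e = 2 \<and> e \<subseteq> B \<and> fst ` e \<subseteq> fst ` c \<and> (\<forall>v\<in>W. \<not> e \<subseteq> v)"
proof -
  define \<alpha> where "\<alpha> = (\<lambda>x. (x, True) \<in> A)"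
  have \<alpha>: "(x, b) \<in> A \<longleftrightarrow> b = \<alpha> x" "(x, b) \<in> B \<longleftrightarrow> b = \<alpha> x" if "x \<in> fst ` c" for x b
  proof -
    have "x \<in> agreed n A B"
      using good that by (rule subsetD)
    then show "(x, b) \<in> A \<longleftrightarrow> b = \<alpha> x" "(x, b) \<in> B \<longleftrightarrow> b = \<alpha> x"
      by (cases b; simp add: agreed_def \<alpha>_def)+
  qed
  have viol: "b \<noteq> \<alpha> x" if "(x, b) \<in> c" for x b
    using c(4) that by (auto simp: satisfies_def \<alpha>_def)
  \<comment> \<open>An empty clause is covered by any two vertices and never satisfied, so it would
    rule out every adjacency.\<close>
  have "c \<noteq> {}"
  proof
    assume "c = {}"
    obtain u v where "adjacent \<phi> u v"
      using W(2) A adj by blast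
    then show False
      using c(3) \<open>c = {}\<close> by (auto simp: adjacent_def)
  qed
  then obtain x where x: "x \<in> fst ` c"
    by auto
  define e where "e = (\<lambda>y. (y, \<alpha> y)) ` (fst ` c - {x})"
  have no: "\<not> e \<subseteq> v" if v: "v \<in> W" for v
  proof
    assume e: "e \<subseteq> v"
    obtain u where u: "(x, \<alpha> x) \<in> u" "u \<subseteq> A" "adjacent \<phi> u v"
      using adj[OF v, of "(x, \<alpha> x)"] \<alpha>(1)[OF x] by auto
    \<comment> \<open>\<open>u\<close> assigns \<open>x\<close> and \<open>v\<close> the other
      variables of \<open>c\<close>. Adjacency then demands a satisfied literal, but all values of
      \<open>A\<close> and \<open>B\<close> on these variables violate \<open>c\<close>.\<close>
    have "fst ` c \<subseteq> fst ` u \<union> fst ` v"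
    proof
      fix y assume y: "y \<in> fst ` c"
      show "y \<in> fst ` u \<union> fst ` v"
      proof (cases "y = x")
        case True
        then show ?thesis
          using u(1) by force
      next
        case False
        then have "(y, \<alpha> y) \<in> v"
          using e y by (auto simp: e_def)
        then show ?thesis
          by force
      qed
    qed
    then have "c \<inter> (u \<union> v) \<noteq> {}"
      using u(3) c(3) by (simp add: adjacent_def)
    then obtain y b where yb: "(y, b) \<in> c" "(y, b) \<in> u \<union> v"
      by auto
    then have "(y, b) \<in> A \<or> (y, b) \<in> B"
      using u(2) v W(1) by auto
    moreover have "y \<in> fst ` c"
      using yb(1) by force
    ultimately show False
      using \<alpha>[of y b] viol[OF yb(1)] by auto
  qed
  have eB: "e \<subseteq> B"
    using \<alpha>(2) by (auto simp: e_def)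
  have fin: "finite e"
    using c(1) by (simp add: e_def)
  have "card (fst ` c) \<le> 3"
    using card_image_le[OF c(1), of fst] c(2) by simp
  then have "card (fst ` c - {x}) \<le> 2"
    using x by simp
  then have "card e \<le> 2"
    unfolding e_def using c(1) by (intro order_trans[OF card_image_le]) auto
  \<comment> \<open>An \<open>e\<close> with at most one element would lie in some \<open>v\<close>
    of \<open>W\<close>, since \<open>W\<close> is nonempty and covers \<open>B\<close>. This
    disposes of clauses with fewer than three variables.\<close>
  moreover have "card e \<noteq> 0"
    using fin no W(2) by auto
  moreover have "card e \<noteq> 1"
  proof
    assume "card e = 1"
    then obtain p where "e = {p}"
      by (auto simp: card_1_singleton_iff)
    then show False
      using eB W(1) no by auto
  qed
  ultimately have "card e = 2"
    by linarith
  moreover have "fst ` e \<subseteq> fst ` c"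
    unfolding e_def image_image by simp
  ultimately show ?thesis
    using eB no by blast
qed

section \<open>Weight estimate for the two sides of one biclique\<close>

text \<open>\<open>k\<close> counts the doubled variables of both sides, the missing variables, and
  a maximal matching \<open>M\<close> of forbidden pairs in \<open>B\<close>. Each gains a factor of
  at least \<open>(1 + z) ^ 2 / (1 + 2 * z)\<close> over the trivial bound. It is linear in
  \<open>n\<close> because the variables behind it meet every violated clause.\<close>

lemma biclique_sides_bound:
  fixes z d \<epsilon> :: real
  assumes sat: "is_3sat n \<phi>" "val \<phi> \<le> 1 - \<epsilon>" "\<forall>x\<in>{1..n}. real (occurrences \<phi> x) \<le> d"
    and pos: "\<epsilon> > 0" "d > 0" "z \<ge> 0"
    and A: "A \<subseteq> {1..n} \<times> UNIV" "A \<noteq> {}" and B: "B \<subseteq> {1..n} \<times> UNIV"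
    and cons: "consistent A B"
    and WA: "WA \<subseteq> partial_assignments n l" "\<Union>WA \<subseteq> A"
    and WB: "WB \<subseteq> partial_assignments n l" "\<Union>WB = B" "WB \<noteq> {}"
    and adj: "\<And>v p. v \<in> WB \<Longrightarrow> p \<in> A \<Longrightarrow> \<exists>u. p \<in> u \<and> u \<subseteq> A \<and> adjacent \<phi> u v"
  shows "\<exists>k::nat. \<epsilon> * n / (6 * d) \<le> k \<and>
    (card WA * z ^ l) * (card WB * z ^ l) * (1 + z) ^ (2 * k) \<le> (1 + 2 * z) ^ k * (1 + z) ^ (2 * n)"
proof -
  define \<alpha> where "\<alpha> = (\<lambda>x. (x, True) \<in> A)"
  define P where "P = {e. card e = 2 \<and> e \<subseteq> B \<and> fst ` e \<subseteq> agreed n A B \<and> (\<forall>v\<in>WB. \<not> e \<subseteq> v)}"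
  have finAB: "finite A" "finite B"
    using A(1) B by (auto intro: finite_subset)
  have finP: "finite P"
    using finAB(2) by (auto simp: P_def intro: finite_subset[of _ "Pow B"])
  have "finite {M. M \<subseteq> P \<and> pairwise disjnt M}" "{} \<in> {M. M \<subseteq> P \<and> pairwise disjnt M}"
    using finP by auto
  then obtain M where M: "M \<subseteq> P" "pairwise disjnt M"
    and max: "\<And>M'. M' \<subseteq> P \<Longrightarrow> pairwise disjnt M' \<Longrightarrow> M \<subseteq> M' \<Longrightarrow> M = M'"
    using finite_has_maximal2[of "{M. M \<subseteq> P \<and> pairwise disjnt M}" "{}"] by auto
  have finM: "finite M"
    using M(1) finP finite_subset by blast
  \<comment> \<open>By maximality of \<open>M\<close>: a forbidden pair disjoint from
    \<open>\<Union>M\<close> could be added.\<close>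
  have meets: "e \<inter> \<Union>M \<noteq> {}" if e: "e \<in> P" for e
  proof (cases "e \<in> M")
    case True
    have "e \<noteq> {}"
      using e by (auto simp: P_def)
    then show ?thesis
      using True by blast
  next
    case False
    then have "\<not> pairwise disjnt (insert e M)"
      using max[of "insert e M"] M(1) e by auto
    then obtain f where "f \<in> M" "\<not> disjnt e f"
      using M(2) by (auto simp: pairwise_insert disjnt_sym)
    then show ?thesis
      by (auto simp: disjnt_def)
  qed
  define bad where "bad = {1..n} - agreed n A B"
  define T where "T = bad \<union> fst ` \<Union>M"
  have finU: "finite (\<Union>M)" "card (\<Union>M) \<le> 2 * card M"
  proof -
    have e: "card e = 2" "finite e" if "e \<in> M" for e
    proof -
      show "card e = 2"
        using that M(1) by (auto simp: P_def)
      then show "finite e"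
        by (metis card.infinite zero_neq_numeral)
    qed
    then show "finite (\<Union>M)"
      using finM by auto
    show "card (\<Union>M) \<le> 2 * card M"
      using card_Union_le_sum_card[of M] e(1) by simp
  qed
  have T: "finite T" "T \<subseteq> {1..n}" "card T \<le> card bad + 2 * card M"
  proof -
    show "finite T"
      using finU by (simp add: T_def bad_def)
    show "T \<subseteq> {1..n}"
      using M(1) by (auto simp: T_def bad_def P_def agreed_def image_subset_iff dest!: subsetD)
    have "card T \<le> card bad + card (fst ` \<Union>M)"
      unfolding T_def by (rule card_Un_le)
    also have "card (fst ` \<Union>M) \<le> card (\<Union>M)"
      using finU(1) by (rule card_image_le)
    finally show "card T \<le> card bad + 2 * card M"
      using finU(2) by linarith
  qed
  \<comment> \<open>\<open>T\<close> hits every violated clause: either the clause has a variable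
    outside \<open>agreed\<close>, or its forbidden pair meets \<open>M\<close>. As a variable lies
    in at most \<open>d\<close> clauses, \<open>T\<close> is large.\<close>
  have "\<exists>x\<in>T. x \<in> fst ` c" if c: "c \<in> set \<phi>" "\<not> satisfies \<alpha> c" for c
  proof (cases "fst ` c \<subseteq> agreed n A B")
    case True
    have "finite c" "card c \<le> 3"
      using sat(1) c(1) by (auto simp: is_3sat_def)
    then obtain e where e: "card e = 2" "e \<subseteq> B" "fst ` e \<subseteq> fst ` c" "\<forall>v\<in>WB. \<not> e \<subseteq> v"
      using forbidden_pair[of c \<phi> A n B WB] c True WB(2,3) A(2) adj unfolding \<alpha>_def by blast
    then have "e \<in> P"
      using True by (auto simp: P_def)
    then obtain p where "p \<in> e" "p \<in> \<Union>M"
      using meets by blast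
    then have "fst p \<in> T" "fst p \<in> fst ` c"
      using e(3) by (auto simp: T_def)
    then show ?thesis ..
  next
    case False
    moreover have "fst ` c \<subseteq> {1..n}"
      using sat(1) c(1) by (auto simp: is_3sat_def formula_vars_def)
    ultimately show ?thesis
      by (auto simp: T_def bad_def)
  qed
  then have "length (filter (\<lambda>c. \<not> satisfies \<alpha> c) \<phi>) \<le> (\<Sum>x\<in>T. occurrences \<phi> x)"
    unfolding occurrences_def by (intro length_filter_le_sum T(1)) auto
  then have "real (length (filter (\<lambda>c. \<not> satisfies \<alpha> c) \<phi>)) \<le> (\<Sum>x\<in>T. real (occurrences \<phi> x))"
    by (metis of_nat_le_iff of_nat_sum)
  also have "\<dots> \<le> (\<Sum>x\<in>T. d)"
    using sat(3) T(2) by (intro sum_mono) auto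
  also have "\<dots> = card T * d"
    by simp
  finally have "\<epsilon> * n / 3 \<le> card T * d"
    using unsatisfied_clauses_ge[OF sat(1,2) pos(1), of \<alpha>] by simp
  define k where "k = card (doubled n A) + card (doubled n B) + card (missing n A B) + card M"
  have "card bad \<le> card (doubled n A) + card (doubled n B) + card (missing n A B)"
  proof -
    have "bad \<subseteq> doubled n A \<union> doubled n B \<union> missing n A B"
      by (auto simp: bad_def missing_def)
    moreover have "finite (doubled n A \<union> doubled n B \<union> missing n A B)"
      by (simp add: doubled_def missing_def)
    ultimately have "card bad \<le> card (doubled n A \<union> doubled n B \<union> missing n A B)"
      by (rule card_mono[rotated])
    then show ?thesis
      using card_Un_le[of "doubled n A" "doubled n B"] card_Un_le[of "doubled n A \<union> doubled n B" "missing n A B"]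
      by linarith
  qed
  then have "card T \<le> 2 * k"
    using T(3) by (simp add: k_def)
  then have "real (card T) * d \<le> real (2 * k) * d"
    using pos(2) by (intro mult_right_mono of_nat_mono) auto
  then have "\<epsilon> * n / 3 \<le> real (2 * k) * d"
    using \<open>\<epsilon> * n / 3 \<le> card T * d\<close> by linarith
  then have k: "\<epsilon> * n / (6 * d) \<le> k"
    using pos(2) by (simp add: field_simps)
  define MA where "MA = doubled_pairs n A"
  define MB where "MB = doubled_pairs n B \<union> M"
  have a: "card WA * z ^ l * (1 + z) ^ (2 * card MA) \<le> (1 + 2 * z) ^ card MA * (1 + z) ^ card A"
  proof (rule card_avoiding_matching)
    fix w assume "w \<in> WA"
    then show "w \<subseteq> A \<and> card w = l \<and> (\<forall>e\<in>MA. \<not> e \<subseteq> w)"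
      using WA doubled_pairs(5) by (auto simp: MA_def partial_assignments_def)
  qed (use pos(3) finAB doubled_pairs in \<open>auto simp: MA_def\<close>)
  \<comment> \<open>The two kinds of pairs in \<open>B\<close> live on doubled and on agreed
    variables, so their union is again a matching.\<close>
  have cross: "disjnt e f" if e: "e \<in> doubled_pairs n B" and f: "f \<in> M" for e f
  proof -
    have "f \<in> P"
      using f M(1) by (rule subsetD[rotated])
    then have "fst ` e \<subseteq> doubled n B" "fst ` f \<subseteq> agreed n A B"
      using doubled_pairs(4)[OF e] by (simp_all add: P_def)
    moreover have "doubled n B \<inter> agreed n A B = {}"
      by (auto simp: doubled_def agreed_def)
    ultimately have "fst ` e \<inter> fst ` f = {}"
      by blast
    then show ?thesis
      unfolding disjnt_def by blast
  qed
  have b: "card WB * z ^ l * (1 + z) ^ (2 * card MB) \<le> (1 + 2 * z) ^ card MB * (1 + z) ^ card B"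
  proof (rule card_avoiding_matching)
    fix w assume w: "w \<in> WB"
    have "inj_on fst w"
      using w WB(1) by (auto simp: partial_assignments_def)
    moreover have "\<not> e \<subseteq> w" if "e \<in> M" for e
    proof -
      have "e \<in> P"
        using that M(1) by (rule subsetD[rotated])
      then show ?thesis
        using w by (simp add: P_def)
    qed
    ultimately have "\<not> e \<subseteq> w" if "e \<in> MB" for e
      using that doubled_pairs(5)[of e n B w] by (auto simp: MB_def)
    moreover have "w \<subseteq> B" "card w = l"
      using w WB by (auto simp: partial_assignments_def)
    ultimately show "w \<subseteq> B \<and> card w = l \<and> (\<forall>e\<in>MB. \<not> e \<subseteq> w)"
      by blast
  next
    fix e assume "e \<in> MB"
    then show "card e = 2 \<and> e \<subseteq> B"
      using doubled_pairs(4) M(1) by (auto simp: MB_def P_def)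
  next
    show "pairwise disjnt MB"
      using doubled_pairs(3)[of n B] M(2) cross
      unfolding MB_def pairwise_def by (metis Un_iff disjnt_sym)
  qed (use pos(3) finAB doubled_pairs finM in \<open>auto simp: MB_def\<close>)
  have "doubled_pairs n B \<inter> M = {}"
  proof (rule ccontr)
    assume "doubled_pairs n B \<inter> M \<noteq> {}"
    then obtain e where "e \<in> doubled_pairs n B" "e \<in> M"
      by blast
    then have "e = {}" "card e = 2"
      using cross doubled_pairs(4) by (auto simp: disjnt_def)
    then show False
      by simp
  qed
  then have cards: "card MA = card (doubled n A)" "card MB = card (doubled n B) + card M"
    by (simp_all add: MA_def MB_def doubled_pairs card_Un_disjoint finM)
  define s where "s = card (missing n A B)"
  have ks: "k = card MA + card MB + s"
    by (simp add: k_def cards s_def)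
  have "(card WA * z ^ l) * (card WB * z ^ l) * (1 + z) ^ (2 * k) =
      (card WA * z ^ l * (1 + z) ^ (2 * card MA)) * (card WB * z ^ l * (1 + z) ^ (2 * card MB)) * (1 + z) ^ (2 * s)"
    by (simp only: ks power_add distrib_left mult_ac)
  also have "\<dots> \<le> ((1 + 2 * z) ^ card MA * (1 + z) ^ card A) * ((1 + 2 * z) ^ card MB * (1 + z) ^ card B) * (1 + z) ^ (2 * s)"
    using pos(3) by (intro mult_right_mono mult_mono a b) auto
  also have "\<dots> = (1 + 2 * z) ^ (card MA + card MB) * (1 + z) ^ (card A + card B + 2 * s)"
    by (simp only: power_add mult_ac)
  \<comment> \<open>The missing variables reduce \<open>card A + card B\<close> by \<open>s\<close>,
    which cancels half of \<open>2 * s\<close>. The remaining \<open>(1 + z) ^ s\<close> is then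
    weakened to \<open>(1 + 2 * z) ^ s\<close>, so that all of \<open>k\<close> enters
    uniformly.\<close>
  also have "\<dots> \<le> (1 + 2 * z) ^ (card MA + card MB) * (1 + z) ^ (2 * n + s)"
    using card_sides_le[OF A(1) B cons] pos(3)
    by (intro mult_left_mono power_increasing) (auto simp: s_def)
  also have "\<dots> = (1 + 2 * z) ^ (card MA + card MB) * ((1 + z) ^ s * (1 + z) ^ (2 * n))"
    by (simp only: power_add mult_ac)
  also have "\<dots> \<le> (1 + 2 * z) ^ (card MA + card MB) * ((1 + 2 * z) ^ s * (1 + z) ^ (2 * n))"
    using pos(3) by (intro mult_left_mono mult_right_mono power_mono) auto
  also have "\<dots> = (1 + 2 * z) ^ k * (1 + z) ^ (2 * n)"
    by (simp only: ks power_add mult_ac)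
  finally show ?thesis
    using k by blast
qed

section \<open>Upper bound on the number of bicliques\<close>

lemma finite_partial_assignments: "finite (partial_assignments n l)"
  by (rule finite_subset[of _ "Pow ({1..n} \<times> UNIV)"]) (auto simp: partial_assignments_def image_subset_iff)

text \<open>At \<open>z = l / (n - l)\<close> the quotient \<open>(1 + 2 * z) / (1 + z) ^ 2\<close>
  equals \<open>1 - (l / n) ^ 2\<close>. Its \<open>k\<close>-th power with \<open>k\<close> linear
  in \<open>n\<close> gives the exponential saving, and \<open>power_le_binomial_mode\<close> is
  applied once for each side.\<close>

lemma biclique_sides_bound_exp:
  fixes d \<epsilon> :: real
  assumes "is_3sat n \<phi>" "val \<phi> \<le> 1 - \<epsilon>" "\<forall>x\<in>{1..n}. real (occurrences \<phi> x) \<le> d"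
    and "\<epsilon> > 0" "d > 0" and l: "0 < l" "l < n"
    and "A \<subseteq> {1..n} \<times> UNIV" "A \<noteq> {}" "B \<subseteq> {1..n} \<times> UNIV" "consistent A B"
    and "WA \<subseteq> partial_assignments n l" "\<Union>WA \<subseteq> A"
    and "WB \<subseteq> partial_assignments n l" "\<Union>WB = B" "WB \<noteq> {}"
    and "\<And>v p. v \<in> WB \<Longrightarrow> p \<in> A \<Longrightarrow> \<exists>u. p \<in> u \<and> u \<subseteq> A \<and> adjacent \<phi> u v"
  shows "real (card WA) * card WB
    \<le> ((real n + 1) * real (n choose l)) ^ 2 * exp (- (\<epsilon> / (6 * d) * real l ^ 2 / n))"
proof -
  define z where "z = real l / real (n - l)"
  define q where "q = real l / real n"
  have z: "z > 0"
    using l by (simp add: z_def)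
  obtain k where k: "\<epsilon> * n / (6 * d) \<le> k" and
    bound: "(card WA * z ^ l) * (card WB * z ^ l) * (1 + z) ^ (2 * k) \<le> (1 + 2 * z) ^ k * (1 + z) ^ (2 * n)"
    using biclique_sides_bound[OF assms(1-5) less_imp_le[OF z] assms(8-17)] by blast
  have nl: "real (n - l) = real n - real l" "real n > real l"
    using l by (auto simp: of_nat_diff)
  have "1 + z = n / (real n - l)" "1 + 2 * z = (real n + l) / (real n - l)"
    using nl by (simp_all add: z_def field_simps)
  moreover have "1 - q ^ 2 = (real n - l) * (real n + l) / n ^ 2"
    using nl by (simp add: q_def field_simps power2_eq_square)
  ultimately have "1 + 2 * z = (1 + z) ^ 2 * (1 - q ^ 2)"
    using nl by (simp add: power2_eq_square)
  also have "\<dots> \<le> (1 + z) ^ 2 * exp (- (q ^ 2))"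
    using exp_ge_add_one_self[of "- (q ^ 2)"] by (intro mult_left_mono) auto
  finally have "(1 + 2 * z) ^ k \<le> ((1 + z) ^ 2 * exp (- (q ^ 2))) ^ k"
    using z by (intro power_mono) auto
  also have "\<dots> = (1 + z) ^ (2 * k) * exp (- (k * q ^ 2))"
    by (simp add: power_mult_distrib power_mult flip: exp_of_nat_mult)
  finally have step1: "(1 + 2 * z) ^ k \<le> (1 + z) ^ (2 * k) * exp (- (k * q ^ 2))" .
  have "\<epsilon> / (6 * d) * real l ^ 2 / n = \<epsilon> * n / (6 * d) * q ^ 2"
    using l by (simp add: q_def power2_eq_square)
  also have "\<dots> \<le> k * q ^ 2"
    using k by (intro mult_right_mono) auto
  finally have step2: "exp (- (k * q ^ 2)) \<le> exp (- (\<epsilon> / (6 * d) * real l ^ 2 / n))"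
    by simp
  have "(1 + z) ^ (2 * n) = ((1 + z) ^ n) ^ 2"
    by (simp add: power_mult power2_eq_square flip: power_add mult_2)
  also have "\<dots> \<le> ((real n + 1) * (real (n choose l) * z ^ l)) ^ 2"
    using power_le_binomial_mode[OF l(2)] z unfolding z_def by (intro power_mono) auto
  finally have step3: "(1 + z) ^ (2 * n) \<le> ((real n + 1) * (real (n choose l) * z ^ l)) ^ 2" .
  have "(card WA * z ^ l) * (card WB * z ^ l) * (1 + z) ^ (2 * k) \<le>
      ((1 + z) ^ (2 * k) * exp (- (\<epsilon> / (6 * d) * real l ^ 2 / n))) * ((real n + 1) * (real (n choose l) * z ^ l)) ^ 2"
    using z step1 step2 step3
    by (intro order_trans[OF bound] mult_mono order_trans[OF step1] mult_left_mono) auto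
  also have "\<dots> = (((real n + 1) * real (n choose l)) ^ 2 * exp (- (\<epsilon> / (6 * d) * real l ^ 2 / n))) * (z ^ l * z ^ l) * (1 + z) ^ (2 * k)"
    by (simp only: power2_eq_square mult_ac)
  finally have "(real (card WA) * card WB) * (z ^ l * z ^ l) * (1 + z) ^ (2 * k) \<le>
    (((real n + 1) * real (n choose l)) ^ 2 * exp (- (\<epsilon> / (6 * d) * real l ^ 2 / n))) * (z ^ l * z ^ l) * (1 + z) ^ (2 * k)"
    by (simp only: mult_ac)
  then show ?thesis
    using z by (simp only: mult_le_cancel_right) auto
qed

text \<open>
  Sort the bicliques by the sets \<open>A\<close> and \<open>B\<close> of all pairs occurring on either side; each of the
  \<open>2 ^ (4 * n)\<close> choices leaves a product set \<open>WA \<times> WB\<close> of possible pairs \<open>(us i, vs j)\<close>.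
\<close>

lemma card_bicliques_le:
  fixes d \<epsilon> :: real
  assumes sat: "is_3sat n \<phi>" "val \<phi> \<le> 1 - \<epsilon>" "\<forall>x\<in>{1..n}. real (occurrences \<phi> x) \<le> d"
    and pos: "\<epsilon> > 0" "d > 0" and l: "0 < l" "l < n" and t: "t > 0"
    and S: "S \<subseteq> partial_assignments n l"
  shows "card (bicliques S (adjacent \<phi>) t)
    \<le> 2 ^ (4 * n) * (((real n + 1) * real (n choose l)) ^ 2 * exp (- (\<epsilon> / (6 * d) * real l ^ 2 / n))) ^ t"
proof -
  define K where "K = ((real n + 1) * real (n choose l)) ^ 2 * exp (- (\<epsilon> / (6 * d) * real l ^ 2 / n))"
  define X where "X = {1..n} \<times> (UNIV :: bool set)"
  define sides where "sides us vs = (\<Union>i<t. us i, \<Union>j<t. vs j)" for us vs :: "nat \<Rightarrow> partial_assignment"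
  define H where "H p = {(us, vs) \<in> bicliques S (adjacent \<phi>) t. sides us vs = p}" for p
  have K: "K \<ge> 0"
    by (simp add: K_def)
  have finS: "finite S"
    using S finite_partial_assignments finite_subset by blast
  have SX: "u \<subseteq> X" "card u = l" if "u \<in> S" for u
  proof -
    have "fst ` u \<subseteq> {1..n}" "card u = l"
      using that S by (auto simp: partial_assignments_def)
    then show "u \<subseteq> X" "card u = l"
      by (auto simp: X_def)
  qed
  have fiber: "card (H p) \<le> K ^ t" if p: "p \<in> Pow X \<times> Pow X" for p
  proof (cases "H p = {}")
    case True
    then show ?thesis
      using K by simp
  next
    case False
    obtain A B where AB: "p = (A, B)" "A \<subseteq> X" "B \<subseteq> X"
      using p by auto
    define WA where "WA = {u \<in> S. u \<subseteq> A}"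
    \<comment> \<open>Adjacency to the actual vertices \<open>us i\<close> is weakened to a
      condition on \<open>A\<close> alone. So \<open>WB\<close> is the same for all bicliques in
      \<open>H p\<close>, while \<open>forbidden_pair\<close> still applies.\<close>
    define WB where "WB = {v \<in> S. v \<subseteq> B \<and> (\<forall>p\<in>A. \<exists>u. p \<in> u \<and> u \<subseteq> A \<and> adjacent \<phi> u v)}"
    have member: "us i \<in> WA \<and> vs i \<in> WB" if H: "(us, vs) \<in> H p" and i: "i < t" for us vs i
    proof -
      have b: "us \<in> {..<t} \<rightarrow>\<^sub>E S" "vs \<in> {..<t} \<rightarrow>\<^sub>E S"
        and a: "\<And>i j. i < t \<Longrightarrow> j < t \<Longrightarrow> adjacent \<phi> (us i) (vs j)"
        and s: "A = (\<Union>i<t. us i)" "B = (\<Union>j<t. vs j)"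
        using H by (simp_all add: H_def bicliques_def sides_def AB(1))
      have "us i \<in> S" "vs i \<in> S"
        using PiE_mem[OF b(1), of i] PiE_mem[OF b(2), of i] i by simp_all
      moreover have "\<exists>u. p \<in> u \<and> u \<subseteq> A \<and> adjacent \<phi> u (vs i)" if "p \<in> A" for p
      proof -
        obtain i' where "i' < t" "p \<in> us i'"
          using \<open>p \<in> A\<close> s(1) by blast
        then show ?thesis
          using s(1) a i by (intro exI[of _ "us i'"]) blast
      qed
      moreover have "us i \<subseteq> A" "vs i \<subseteq> B"
        using i s by blast+
      ultimately show ?thesis
        by (simp add: WA_def WB_def)
    qed
    obtain us vs where H: "(us, vs) \<in> H p"
      using False by auto
    then have a: "\<And>i j. i < t \<Longrightarrow> j < t \<Longrightarrow> adjacent \<phi> (us i) (vs j)"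
      and s: "A = (\<Union>i<t. us i)" "B = (\<Union>j<t. vs j)"
      by (simp_all add: H_def bicliques_def sides_def AB(1))
    have "real (card WA) * card WB \<le> K"
      unfolding K_def
    proof (rule biclique_sides_bound_exp[OF sat pos l])
      show "A \<subseteq> {1..n} \<times> UNIV" "B \<subseteq> {1..n} \<times> UNIV"
        using AB by (simp_all add: X_def)
      have "us 0 \<in> S" "us 0 \<subseteq> A"
        using member[OF H t] by (simp_all add: WA_def)
      then show "A \<noteq> {}"
        using SX(2)[of "us 0"] l(1) by auto
      show "consistent A B"
        unfolding consistent_def
      proof (intro allI impI)
        fix x b b' assume "(x, b) \<in> A" "(x, b') \<in> B"
        then obtain i j where "i < t" "j < t" "(x, b) \<in> us i" "(x, b') \<in> vs j"
          using s by blast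
        then show "b = b'"
          using a[of i j] unfolding adjacent_def consistent_def by blast
      qed
      show "WA \<subseteq> partial_assignments n l" "WB \<subseteq> partial_assignments n l"
        using S by (auto simp: WA_def WB_def)
      show "\<Union>WA \<subseteq> A"
        by (auto simp: WA_def)
      have "B \<subseteq> \<Union>WB"
        unfolding s(2) using member[OF H] by blast
      then show "\<Union>WB = B"
        by (auto simp: WB_def)
      show "WB \<noteq> {}"
        using member[OF H t] by auto
      show "\<exists>u. p \<in> u \<and> u \<subseteq> A \<and> adjacent \<phi> u v" if "v \<in> WB" "p \<in> A" for v p
        using that by (simp add: WB_def)
    qed
    have "H p \<subseteq> ({..<t} \<rightarrow>\<^sub>E WA) \<times> ({..<t} \<rightarrow>\<^sub>E WB)"
    proof (rule subrelI)
      fix us vs assume H: "(us, vs) \<in> H p"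
      then have "us \<in> extensional {..<t}" "vs \<in> extensional {..<t}"
        by (simp_all add: H_def bicliques_def PiE_iff)
      then show "(us, vs) \<in> ({..<t} \<rightarrow>\<^sub>E WA) \<times> ({..<t} \<rightarrow>\<^sub>E WB)"
        using member[OF H] by (simp add: PiE_iff)
    qed
    moreover have "finite (({..<t} \<rightarrow>\<^sub>E WA) \<times> ({..<t} \<rightarrow>\<^sub>E WB))"
      using finS by (intro finite_cartesian_product finite_PiE) (simp_all add: WA_def WB_def)
    ultimately have "card (H p) \<le> card (({..<t} \<rightarrow>\<^sub>E WA) \<times> ({..<t} \<rightarrow>\<^sub>E WB))"
      by (rule card_mono[rotated])
    also have "\<dots> = (card WA * card WB) ^ t"
      by (simp add: card_cartesian_product card_funcsetE power_mult_distrib)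
    finally have "real (card (H p)) \<le> (real (card WA) * card WB) ^ t"
      by (metis of_nat_le_iff of_nat_mult of_nat_power)
    also have "\<dots> \<le> K ^ t"
      using \<open>real (card WA) * card WB \<le> K\<close> by (intro power_mono) auto
    finally show ?thesis .
  qed
  have "bicliques S (adjacent \<phi>) t \<subseteq> (\<Union>p\<in>Pow X \<times> Pow X. H p)"
  proof (rule subrelI)
    fix us vs assume b: "(us, vs) \<in> bicliques S (adjacent \<phi>) t"
    then have "us i \<in> S" "vs i \<in> S" if "i < t" for i
      using that by (simp_all add: bicliques_def PiE_iff)
    then have "sides us vs \<in> Pow X \<times> Pow X"
      using SX(1) unfolding sides_def by blast
    then show "(us, vs) \<in> (\<Union>p\<in>Pow X \<times> Pow X. H p)"
      using b by (simp add: H_def)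
  qed
  moreover have "finite (\<Union>p\<in>Pow X \<times> Pow X. H p)"
    by (rule finite_subset[OF _ finite_bicliques[OF finS, of "adjacent \<phi>" t]]) (auto simp: H_def)
  ultimately have "card (bicliques S (adjacent \<phi>) t) \<le> card (\<Union>p\<in>Pow X \<times> Pow X. H p)"
    by (rule card_mono[rotated])
  also have "\<dots> \<le> (\<Sum>p\<in>Pow X \<times> Pow X. card (H p))"
    by (rule card_UN_le) (simp add: X_def)
  finally have "real (card (bicliques S (adjacent \<phi>) t)) \<le> (\<Sum>p\<in>Pow X \<times> Pow X. real (card (H p)))"
    by (metis of_nat_le_iff of_nat_sum)
  also have "\<dots> \<le> (\<Sum>p\<in>Pow X \<times> Pow X. K ^ t)"
    using fiber by (rule sum_mono)
  also have "\<dots> = 2 ^ (4 * n) * K ^ t"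
  proof -
    have "card (Pow X \<times> Pow X) = 2 ^ (n * 2) * 2 ^ (n * 2)"
      by (simp add: card_cartesian_product card_Pow X_def)
    also have "\<dots> = 2 ^ (4 * n)"
      by (simp flip: power_add)
    finally show ?thesis
      by simp
  qed
  finally show ?thesis
    by (simp add: K_def)
qed

section \<open>From the number of bicliques to the density\<close>

text \<open>Each edge comes from some ordered pair, and \<open>N choose 2\<close> is at least
  \<open>N ^ 2 / 4\<close> for \<open>N\<close> at least \<open>2\<close>. For smaller
  \<open>N\<close> the density is a division by zero, hence \<open>0\<close>.\<close>

lemma density_le_ordered_pairs:
  assumes "S \<subseteq> partial_assignments n l"
  shows "density (induced_subgraph (assignment_graph n \<phi> l) S)
    \<le> 4 * (card {(u, v) \<in> S \<times> S. adjacent \<phi> u v} / real (card S) ^ 2)"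
proof -
  define R where "R = {(u, v) \<in> S \<times> S. adjacent \<phi> u v}"
  define E where "E = edges (induced_subgraph (assignment_graph n \<phi> l) S)"
  define N where "N = card S"
  have "finite S"
    using assms finite_partial_assignments finite_subset by blast
  then have "finite R"
    by (intro finite_subset[of R "S \<times> S"]) (auto simp: R_def)
  have "E \<subseteq> (\<lambda>(u, v). {u, v}) ` R"
    by (auto simp: E_def R_def edges_def induced_subgraph_def assignment_graph_def)
  then have E: "card E \<le> card R"
    using \<open>finite R\<close> by (meson card_image_le card_mono finite_imageI order_trans)
  have d: "density (induced_subgraph (assignment_graph n \<phi> l) S) = card E / real (N choose 2)"
    by (simp add: density_def E_def N_def verts_def induced_subgraph_def)
  show ?thesis
  proof (cases "N \<ge> 2")
    case False
    then show ?thesis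
      by (simp add: d binomial_eq_0)
  next
    case True
    have "real (N choose 2) = real N * (real N - 1) / 2"
      using True by (simp add: choose_two real_of_nat_div of_nat_diff)
    moreover have "real N * (real N / 2) \<le> real N * (real N - 1)"
      using True by (intro mult_left_mono) auto
    ultimately have "real N ^ 2 / 4 \<le> real (N choose 2)"
      by (simp add: power2_eq_square)
    then have "card E / real (N choose 2) \<le> card R / (real N ^ 2 / 4)"
      using E True by (intro frac_le) auto
    then show ?thesis
      by (simp add: d R_def N_def mult.commute)
  qed
qed

text \<open>The choice of \<open>t\<close> makes the number \<open>2 ^ (4 * n)\<close> of possible side sets negligible.\<close>

lemma density_from_bicliques:
  fixes D \<gamma> :: real and n l :: nat
  assumes D: "D \<ge> 0" and \<gamma>: "0 < \<gamma>" "\<gamma> \<le> 1" and l: "0 < l" "l \<le> n"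
    and large: "8 * sqrt n \<le> \<gamma> * real l ^ 2 / n"
    and count: "\<And>t. t > 0 \<Longrightarrow> D ^ (t * t) \<le> 2 ^ (4 * n) * ((real n + 1) ^ 2 * exp (- (\<gamma> * real l ^ 2 / n))) ^ t"
  shows "D \<le> exp (- (\<gamma> ^ 2 * real l ^ 4 / (128 * real n ^ 3)))"
proof -
  define y where "y = \<gamma> * real l ^ 2 / n"
  have n: "n > 0"
    using l by simp
  have y: "y > 0"
    using \<gamma> l n by (simp add: y_def)
  have "\<gamma> * real l ^ 2 \<le> 1 * real n ^ 2"
    using \<gamma> l by (intro mult_mono power_mono) auto
  then have yn: "y \<le> n"
    using n by (simp add: y_def divide_le_eq power2_eq_square)
  \<comment> \<open>With \<open>t\<close> at least \<open>16 * n / y\<close>, the cost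
    \<open>4 * n\<close> of choosing the sides is at most \<open>t * y / 4\<close>, half of the
    exponent \<open>t * y / 2\<close> that is left after absorbing \<open>(n + 1) ^ 2\<close>. Since
    \<open>y\<close> is at most \<open>n\<close>, rounding up at most doubles
    \<open>16 * n / y\<close>.\<close>
  define t where "t = nat \<lceil>16 * n / y\<rceil>"
  have t1: "16 * n / y \<le> t"
    unfolding t_def by (rule real_nat_ceiling_ge)
  have "1 \<le> 16 * n / y"
    using y yn by (simp add: le_divide_eq)
  moreover have "real t \<le> 16 * n / y + 1"
    using of_int_ceiling_le_add_one[of "16 * n / y"] y by (simp add: t_def)
  ultimately have t2: "t \<le> 32 * n / y"
    by simp
  have "real t > 0"
    using t1 \<open>1 \<le> 16 * n / y\<close> by linarith
  then have t0: "t > 0"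
    by simp
  \<comment> \<open>Through \<open>exp (2 * sqrt n)\<close>, the polynomial factor
    \<open>(n + 1) ^ 2\<close> is at most \<open>exp (y / 2)\<close> by the hypothesis
    \<open>large\<close>.\<close>
  have "1 + 2 * sqrt n + 2 * real n \<le> exp (2 * sqrt n)"
    using exp_lower_Taylor_quadratic[of "2 * sqrt n"] by (simp add: power_mult_distrib)
  then have "real n + 1 \<le> exp (2 * sqrt n)"
    using real_sqrt_ge_zero[of n] by linarith
  then have "(real n + 1) ^ 2 \<le> exp (2 * sqrt n) ^ 2"
    by (intro power_mono) auto
  also have "\<dots> = exp (4 * sqrt n)"
    by (simp flip: exp_of_nat_mult)
  also have "\<dots> \<le> exp (y / 2)"
    using large by (simp add: y_def)
  finally have "(real n + 1) ^ 2 * exp (- y) \<le> exp (y / 2) * exp (- y)"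
    by (intro mult_right_mono) auto
  also have "\<dots> = exp (- (y / 2))"
    by (simp flip: exp_add)
  finally have "((real n + 1) ^ 2 * exp (- y)) ^ t \<le> exp (- (y / 2)) ^ t"
    by (intro power_mono) auto
  moreover have "2 ^ (4 * n) \<le> exp (1 :: real) ^ (4 * n)"
    using exp_ge_add_one_self[of 1] by (intro power_mono) auto
  ultimately have "2 ^ (4 * n) * ((real n + 1) ^ 2 * exp (- y)) ^ t \<le> exp 1 ^ (4 * n) * exp (- (y / 2)) ^ t"
    by (intro mult_mono) auto
  then have "D ^ (t * t) \<le> exp 1 ^ (4 * n) * exp (- (y / 2)) ^ t"
    using count[OF t0] unfolding y_def by linarith
  also have "\<dots> = exp (real (4 * n) * 1 + t * (- (y / 2)))"
    by (simp only: exp_add exp_of_nat_mult)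
  also have "\<dots> \<le> exp (t * (- (y / 4)))"
    using t1 y by (simp add: divide_le_eq)
  also have "\<dots> = exp (- (y / 4)) ^ t"
    by (rule exp_of_nat_mult)
  finally have "(D ^ t) ^ t \<le> exp (- (y / 4)) ^ t"
    by (simp add: power_mult)
  then have "D ^ t \<le> exp (- (y / 4))"
    using t0 D by (simp add: power_mono_iff)
  \<comment> \<open>The upper bound \<open>32 * n / y\<close> on \<open>t\<close> writes
    \<open>exp (- (y / 4))\<close> as at least a \<open>t\<close>-th power on the right, ready for a
    second \<open>t\<close>-th root.\<close>
  also have "\<dots> \<le> exp (t * (- (y ^ 2 / (128 * n))))"
  proof -
    have "t * (y ^ 2 / (128 * n)) \<le> 32 * n / y * (y ^ 2 / (128 * n))"
      using t2 by (intro mult_right_mono) auto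
    also have "\<dots> = y / 4"
      using y n by (simp add: power2_eq_square)
    finally show ?thesis
      by simp
  qed
  also have "\<dots> = exp (- (y ^ 2 / (128 * n))) ^ t"
    by (rule exp_of_nat_mult)
  finally have "D \<le> exp (- (y ^ 2 / (128 * n)))"
    using t0 D by (simp add: power_mono_iff)
  also have "y ^ 2 / (128 * n) = \<gamma> ^ 2 * real l ^ 4 / (128 * real n ^ 3)"
    by (simp add: y_def power_divide power_mult_distrib power2_eq_square power3_eq_cube power4_eq_xxxx mult_ac)
  finally show ?thesis .
qed

section \<open>Choice of constants and conclusion\<close>

theorem theorem3p1:
  fixes d \<epsilon> :: real
  assumes "d > 0" and "\<epsilon> > 0"
  shows "\<exists>\<delta>::real. \<delta> > 0 \<and>
    (\<forall>(n::nat) (\<phi>::formula) (l::nat) (S::partial_assignment set).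
       is_3sat n \<phi> \<longrightarrow>
       val \<phi> \<le> 1 - \<epsilon> \<longrightarrow>
       (\<forall>x\<in>{1..n}. real (occurrences \<phi> x) \<le> d) \<longrightarrow>
       1 \<le> l \<longrightarrow> l \<le> n \<longrightarrow>
       real n powr (3/4) / \<delta> \<le> real l \<longrightarrow> real l \<le> real n / 2 \<longrightarrow>
       S \<subseteq> verts (assignment_graph n \<phi> l) \<longrightarrow>
       card S = n choose l \<longrightarrow>
       density (induced_subgraph (assignment_graph n \<phi> l) S)
         \<le> 2 powr (- (\<delta> * real l ^ 4 / real n ^ 3)))"
proof -
  \<comment> \<open>The minimum with \<open>1\<close> ensures the bound \<open>y \<le> n\<close> of
    \<open>density_from_bicliques\<close>. The \<open>512\<close> makes the exponent obtained there,
    with constant \<open>\<gamma> ^ 2 / 128\<close>, equal to \<open>4 * \<delta>\<close> times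
    \<open>l ^ 4 / n ^ 3\<close>.\<close>
  define \<gamma> where "\<gamma> = min 1 (\<epsilon> / (6 * d))"
  define \<delta> where "\<delta> = \<gamma> ^ 2 / 512"
  have \<gamma>: "0 < \<gamma>" "\<gamma> \<le> 1" "\<gamma> \<le> \<epsilon> / (6 * d)"
    using assms by (simp_all add: \<gamma>_def)
  have "\<gamma> ^ 2 \<le> \<gamma>"
    using \<gamma> by (simp add: power2_eq_square mult_left_le)
  then have \<delta>: "0 < \<delta>" "\<delta> \<le> \<gamma> / 512" "\<delta> \<le> 1"
    using \<gamma> by (simp_all add: \<delta>_def)
  show ?thesis
  proof (intro exI[of _ \<delta>] conjI allI impI \<delta>(1))
    fix n l :: nat and \<phi> :: formula and S :: "partial_assignment set"
    assume sat: "is_3sat n \<phi>" "val \<phi> \<le> 1 - \<epsilon>" "\<forall>x\<in>{1..n}. real (occurrences \<phi> x) \<le> d"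
      and l: "1 \<le> l" "l \<le> n" "real n powr (3/4) / \<delta> \<le> real l" "real l \<le> real n / 2"
      and S: "S \<subseteq> verts (assignment_graph n \<phi> l)" "card S = n choose l"
    have ln: "0 < l" "l < n"
      using l by linarith+
    then have n: "real n > 0"
      by simp
    have S': "S \<subseteq> partial_assignments n l"
      using S(1) by (simp add: verts_def assignment_graph_def)
    have finS: "finite S"
      using S' finite_partial_assignments finite_subset by blast
    define N where "N = real (n choose l)"
    have N: "N > 0"
      using l(2) by (simp add: N_def)
    then have "S \<noteq> {}"
      using S(2) by (auto simp: N_def)
    \<comment> \<open>The lower bound on \<open>l\<close> is used twice in this form: its square
      root gives \<open>large\<close>, and below it gives
      \<open>1 \<le> \<delta> * L\<close>.\<close>
    have "real n ^ 3 = (real n powr (3/4)) ^ 4"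
      using n by (simp flip: powr_realpow powr_numeral add: powr_powr)
    also have "\<dots> \<le> (\<delta> * l) ^ 4"
      using l(3) \<delta>(1) by (intro power_mono) (auto simp: divide_le_eq mult.commute)
    finally have n3: "real n ^ 3 \<le> (\<delta> * l) ^ 4" .
    have "real n * sqrt n \<le> (\<delta> * l) ^ 2"
    proof (rule power2_le_imp_le)
      have "(real n * sqrt n) ^ 2 = real n ^ 3"
        by (simp add: power_mult_distrib power2_eq_square power3_eq_cube)
      then show "(real n * sqrt n) ^ 2 \<le> ((\<delta> * l) ^ 2) ^ 2"
        using n3 by simp
    qed simp
    then have "8 * sqrt n \<le> 8 * (\<delta> ^ 2 * real l ^ 2 / n)"
      using n by (simp add: le_divide_eq power_mult_distrib mult.commute)
    also have "8 * (\<delta> ^ 2 * real l ^ 2 / n) = 8 * \<delta> ^ 2 * real l ^ 2 / n"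
      by simp
    also have "\<dots> \<le> \<gamma> * real l ^ 2 / n"
    proof -
      have "\<delta> ^ 2 \<le> \<delta>"
        using \<delta> by (simp add: power2_eq_square mult_left_le)
      then have "8 * \<delta> ^ 2 \<le> \<gamma>"
        using \<delta>(2) \<gamma>(1) by linarith
      then show ?thesis
        by (intro divide_right_mono mult_right_mono) auto
    qed
    finally have large: "8 * sqrt n \<le> \<gamma> * real l ^ 2 / n" .
    define D where "D = card {(u, v) \<in> S \<times> S. adjacent \<phi> u v} / N ^ 2"
    have D: "D \<ge> 0"
      by (simp add: D_def)
    have "D \<le> exp (- (\<gamma> ^ 2 * real l ^ 4 / (128 * real n ^ 3)))"
    proof (rule density_from_bicliques[OF D \<gamma>(1,2) ln(1) less_imp_le[OF ln(2)] large])
      fix t :: nat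
      assume t: "t > 0"
      have "\<gamma> * real l ^ 2 / n \<le> \<epsilon> / (6 * d) * real l ^ 2 / n"
        using \<gamma>(3) by (intro divide_right_mono mult_right_mono) auto
      then have weaken: "exp (- (\<epsilon> / (6 * d) * real l ^ 2 / n)) \<le> exp (- (\<gamma> * real l ^ 2 / n))"
        by (simp only: exp_le_cancel_iff neg_le_iff_le)
      have "(N ^ 2) ^ t * D ^ (t * t) \<le> card (bicliques S (adjacent \<phi>) t)"
        using card_bicliques_ge[OF finS \<open>S \<noteq> {}\<close>, of t "adjacent \<phi>"] by (simp add: S(2) D_def N_def)
      also have "\<dots> \<le> 2 ^ (4 * n) * (((real n + 1) * N) ^ 2 * exp (- (\<epsilon> / (6 * d) * real l ^ 2 / n))) ^ t"
        using card_bicliques_le[OF sat assms(2,1) ln t S'] by (simp add: N_def)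
      also have "\<dots> \<le> 2 ^ (4 * n) * (((real n + 1) * N) ^ 2 * exp (- (\<gamma> * real l ^ 2 / n))) ^ t"
        using weaken by (intro mult_left_mono power_mono) auto
      also have "\<dots> = (N ^ 2) ^ t * (2 ^ (4 * n) * ((real n + 1) ^ 2 * exp (- (\<gamma> * real l ^ 2 / n))) ^ t)"
        by (simp only: power_mult_distrib mult_ac)
      finally show "D ^ (t * t) \<le> 2 ^ (4 * n) * ((real n + 1) ^ 2 * exp (- (\<gamma> * real l ^ 2 / n))) ^ t"
        using N by (simp only: mult_le_cancel_left_pos zero_less_power)
    qed
    define L where "L = real l ^ 4 / real n ^ 3"
    have "1 \<le> \<delta> ^ 4 * L"
      using n3 n by (simp add: L_def le_divide_eq power_mult_distrib)
    also have "\<delta> ^ 4 * L \<le> \<delta> * L"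
    proof (intro mult_right_mono)
      show "\<delta> ^ 4 \<le> \<delta>"
        using power_decreasing[of 1 4 \<delta>] \<delta> by simp
      show "0 \<le> L"
        by (simp add: L_def)
    qed
    finally have L: "1 \<le> \<delta> * L" .
    have "density (induced_subgraph (assignment_graph n \<phi> l) S) \<le> 4 * D"
      using density_le_ordered_pairs[OF S', of \<phi>] by (simp add: D_def N_def S(2))
    \<comment> \<open>The exponent has a surplus of \<open>3 * (\<delta> * L)\<close>, at least
      \<open>3\<close>. It pays for the factor \<open>4\<close>, which is at most
      \<open>exp 2\<close>, and for the passage to base \<open>2\<close>.\<close>
    also have "\<dots> \<le> 4 * exp (- (4 * (\<delta> * L)))"
      using \<open>D \<le> _\<close> by (simp add: \<delta>_def L_def)
    also have "\<dots> \<le> exp 2 * exp (- (4 * (\<delta> * L)))"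
    proof -
      have "(2 :: real) ^ 2 \<le> exp 1 ^ 2"
        using exp_ge_add_one_self[of 1] by (intro power_mono) auto
      then show ?thesis
        by (simp flip: exp_of_nat_mult)
    qed
    also have "\<dots> = exp (2 - 4 * (\<delta> * L))"
      by (simp flip: exp_add)
    also have "\<dots> \<le> exp (- (\<delta> * L) * ln 2)"
    proof -
      have "\<delta> * L * ln 2 \<le> \<delta> * L * 1"
        using L ln_le_minus_one[of 2] by (intro mult_left_mono) auto
      then show ?thesis
        using L by simp
    qed
    also have "\<dots> = 2 powr (- (\<delta> * real l ^ 4 / real n ^ 3))"
      by (simp add: powr_def L_def)
    finally show "density (induced_subgraph (assignment_graph n \<phi> l) S)
         \<le> 2 powr (- (\<delta> * real l ^ 4 / real n ^ 3))" .
  qed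
qed

end
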